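(* Let $n \ge 1$ be an integer and let $A \subseteq \mathbb{Z}_n \setminus \{0\}$ with $|A| = k \le 5$. Then there is an ordering $(a_1,\dots,a_k)$ of the elements of $A$ such that the partial sums $s_j = \sum_{i=1}^{j} a_i$ ($1 \le j \le k$, computed in $\mathbb{Z}_n$) are pairwise distinct. *)

theory Defs
  imports "HOL-Algebra.Elementary_Groups" "HOL-Algebra.FiniteProduct"
begin

text \<open>The cyclic group of order \<open>n\<close> is the library's \<^const>\<open>integer_mod_group\<close>: for \<open>n \<ge> 1\<close> its carrier
  is \<open>{0..<int n}\<close> and its operation, which the library writes multiplicatively, is addition
  modulo \<open>n\<close>. So \<open>\<one>\<close> is the residue \<open>0\<close>, and \<^const>\<open>finprod\<close> is a sum of residues:\<close>

lemma finprod_integer_mod_group: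
  assumes "finite I" and "\<And>i. i \<in> I \<Longrightarrow> f i \<in> carrier (integer_mod_group n)"
  shows "(\<Otimes>\<^bsub>integer_mod_group n\<^esub>i\<in>I. f i) = (\<Sum>i\<in>I. f i) mod int n"
proof -
  interpret comm_group "integer_mod_group n"
    by simp
  show ?thesis
    using assms
  proof (induction I rule: finite_induct)
    case (insert x F)
    then have "f \<in> F \<rightarrow> carrier (integer_mod_group n)" "f x \<in> carrier (integer_mod_group n)"
      by auto
    with insert show ?case
      by (simp add: mod_add_right_eq)
  qed simp
qed

end

(* Two partial sums coincide iff a block of consecutive terms, not containing the first one, sums to
   zero.  Take as first term any c different from the total of A, so that the remaining set B of at
   most four elements has nonzero sum t.  Then only proper blocks of B are dangerous: those of length
   two and, if B has four elements, those of length three, which vanish iff the omitted end is t.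
   If x + y = 0 for distinct x, y in B, then x + u and y + u are nonzero for all other u in B, so
   three elements can be ordered x, z, y.  For four elements name the pair such that y is not t; as
   t = z + w differs from z, the order z, x, w, y works.  If there is no such pair, any order that
   keeps t away from the ends works. *)

theory Submission
  imports Defs "HOL-Library.Sublist"
begin

text \<open>Vanishing of a residue is expressed as divisibility by \<open>m\<close>, so block sums
  stay plain integer sums.\<close>

definition zero_block_free :: "int \<Rightarrow> int list \<Rightarrow> bool" where
  "zero_block_free m xs \<longleftrightarrow> (\<forall>ys. sublist ys xs \<longrightarrow> ys \<noteq> [] \<longrightarrow> \<not> m dvd sum_list ys)"

lemma zero_block_free_Nil [simp]: "zero_block_free m []"
  by (simp add: zero_block_free_def)

lemma all_prefix_Cons:
  "(\<forall>ys. prefix ys (x # xs) \<longrightarrow> P ys) \<longleftrightarrow> P [] \<and> (\<forall>ys. prefix ys xs \<longrightarrow> P (x # ys))"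
  by (auto simp: prefix_Cons)

text \<open>A block of \<open>x # xs\<close> either lies in \<open>xs\<close> or is \<open>x\<close>
  followed by a prefix of \<open>xs\<close>. On explicit lists this unfolds the property into
  finitely many non-divisibilities.\<close>

lemma zero_block_free_Cons:
  "zero_block_free m (x # xs) \<longleftrightarrow>
    zero_block_free m xs \<and> (\<forall>ys. prefix ys xs \<longrightarrow> \<not> m dvd x + sum_list ys)"
  by (auto simp: zero_block_free_def sublist_Cons_right imp_disjL all_conj_distrib all_prefix_Cons)

lemmas zero_block_free_simps = zero_block_free_Cons all_prefix_Cons

text \<open>A vanishing pair is harmless once its members are separated by the third element. The
  pair \<open>x\<close>, \<open>z\<close> needs no case of its own, being already separated in the
  order \<open>x\<close>, \<open>y\<close>, \<open>z\<close>.\<close>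

lemma exists_zero_block_free_3:
  fixes m :: int
  assumes B: "B = {x, y, z}" "distinct [x, y, z]"
    and nz: "\<And>x. x \<in> B \<Longrightarrow> \<not> m dvd x"
    and inc: "\<And>x y. x \<in> B \<Longrightarrow> y \<in> B \<Longrightarrow> m dvd x - y \<Longrightarrow> x = y"
    and t: "\<not> m dvd x + y + z"
  shows "\<exists>xs. distinct xs \<and> set xs = B \<and> zero_block_free m xs"
proof -
  have ordering: ?thesis
    if "{u, v, w} = B" "distinct [u, v, w]" "\<not> m dvd u + v" "\<not> m dvd v + w"
      "\<not> m dvd u + (v + w)" for u v w
    using that nz by (intro exI[of _ "[u, v, w]"]) (auto simp: zero_block_free_simps)
  \<comment> \<open>Two vanishing pairs sharing \<open>v\<close> would make \<open>u\<close> and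
    \<open>w\<close> congruent.\<close>
  have no_two: "\<not> m dvd v + w" if "m dvd u + v" "u \<in> B" "w \<in> B" "u \<noteq> w" for u v w
    using inc[of u w] that dvd_diff[of m "u + v" "v + w"] by auto
  consider "m dvd x + y" | "m dvd y + z" | "\<not> m dvd x + y" "\<not> m dvd y + z"
    by blast
  then show ?thesis
  proof cases
    case 1
    then show ?thesis
      using B t no_two[of x y z] no_two[of y x z]
      by (intro ordering[of x z y]) (auto simp: ac_simps)
  next
    case 2
    then show ?thesis
      using B t no_two[of y z x] no_two[of z y x]
      by (intro ordering[of y x z]) (auto simp: ac_simps)
  next
    case 3
    then show ?thesis
      using B t by (intro ordering[of x y z]) (auto simp: ac_simps)
  qed
qed

lemma exists_zero_block_free_4:
  fixes m :: int
  assumes card: "card B = 4"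
    and nz: "\<And>x. x \<in> B \<Longrightarrow> \<not> m dvd x"
    and inc: "\<And>x y. x \<in> B \<Longrightarrow> y \<in> B \<Longrightarrow> m dvd x - y \<Longrightarrow> x = y"
    and t: "\<not> m dvd \<Sum>B"
  shows "\<exists>xs. distinct xs \<and> set xs = B \<and> zero_block_free m xs"
proof -
  have fin: "finite B"
    using card by (auto intro: card_ge_0_finite)
  \<comment> \<open>The two blocks of length three are the total minus one end, hence the form of
    \<open>ends\<close>.\<close>
  have ordering: ?thesis
    if B: "B = {u, v, w, x}" and d: "distinct [u, v, w, x]"
      and "\<not> m dvd u + v" "\<not> m dvd v + w" "\<not> m dvd w + x"
      and ends: "\<not> m dvd \<Sum>B - u" "\<not> m dvd \<Sum>B - x" for u v w x
  proof -
    have "\<Sum>B = u + (v + (w + x))"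
      using B d by simp
    with that nz t show ?thesis
      by (intro exI[of _ "[u, v, w, x]"]) (auto simp: zero_block_free_simps algebra_simps)
  qed
  show ?thesis
  proof (cases "\<exists>x\<in>B. \<exists>y\<in>B. x \<noteq> y \<and> m dvd x + y")
    case True
    then obtain p q where pq: "p \<in> B" "q \<in> B" "p \<noteq> q" "m dvd p + q"
      by blast
    \<comment> \<open>Otherwise \<open>p\<close> and \<open>q\<close> would both be congruent to the
      total. The pair is symmetric, so the good element may be named \<open>y\<close>.\<close>
    then have "\<not> m dvd \<Sum>B - p \<or> \<not> m dvd \<Sum>B - q"
      using inc[of q p] dvd_diff[of m "\<Sum>B - p" "\<Sum>B - q"] by auto
    then obtain x y where xy: "x \<in> B" "y \<in> B" "x \<noteq> y" "m dvd x + y" "\<not> m dvd \<Sum>B - y"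
      using pq by (metis add.commute)
    have "card (B - {x, y}) = 2"
      using card fin xy by (simp add: card_Diff_subset)
    then obtain z w where zw: "B - {x, y} = {z, w}" "z \<noteq> w"
      by (meson card_2_iff)
    then have B: "B = {z, x, w, y}" "distinct [z, x, w, y]"
      using xy by auto
    then have sum: "\<Sum>B = z + (x + (w + y))"
      by simp
    \<comment> \<open>Each of these pairs shares exactly one element with the vanishing pair
      \<open>x\<close>, \<open>y\<close>; subtracting would make two distinct elements
      congruent.\<close>
    have "\<not> m dvd z + x" "\<not> m dvd x + w" "\<not> m dvd w + y"
      using inc[of z y] inc[of w y] inc[of w x] B xy(4)
        dvd_diff[of m "z + x" "x + y"] dvd_diff[of m "x + w" "x + y"] dvd_diff[of m "w + y" "x + y"]
      by auto
    \<comment> \<open>The block \<open>x\<close>, \<open>w\<close>, \<open>y\<close> contains the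
      vanishing pair, so its sum is congruent to \<open>w\<close>.\<close>
    moreover have "\<not> m dvd \<Sum>B - z"
    proof
      assume "m dvd \<Sum>B - z"
      then have "m dvd (\<Sum>B - z) - (x + y)"
        using xy(4) by (rule dvd_diff)
      then show False
        using sum B nz[of w] by simp
    qed
    ultimately show ?thesis
      using ordering B xy(5) by blast
  next
    case False
    \<comment> \<open>At most one element is congruent to the total; it is taken as \<open>z\<close>
      if it exists, and otherwise any \<open>z\<close> will do. Below, \<open>z\<close> is placed in
      an inner position.\<close>
    obtain z where z: "z \<in> B" "\<And>u. u \<in> B \<Longrightarrow> u \<noteq> z \<Longrightarrow> \<not> m dvd \<Sum>B - u"
    proof (cases "\<exists>z\<in>B. m dvd \<Sum>B - z")
      case True
      then obtain z where z: "z \<in> B" "m dvd \<Sum>B - z"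
        by blast
      moreover have "\<not> m dvd \<Sum>B - u" if "u \<in> B" "u \<noteq> z" for u
        using inc[of u z] that z dvd_diff[of m "\<Sum>B - z" "\<Sum>B - u"] by auto
      ultimately show ?thesis
        using that by blast
    next
      case False
      moreover have "B \<noteq> {}"
        using card by auto
      ultimately show ?thesis
        using that by blast
    qed
    have "card (B - {z}) = 3"
      using card fin z by simp
    then obtain u v w where "B - {z} = {u, v, w}" "u \<noteq> v" "v \<noteq> w" "u \<noteq> w"
      by (auto simp: card_3_iff)
    then have B: "B = {u, z, v, w}" "distinct [u, z, v, w]"
      using z by auto
    then have "\<not> m dvd u + z" "\<not> m dvd z + v" "\<not> m dvd v + w"
      using False by auto
    then show ?thesis
      using ordering[OF B] z(2)[of u] z(2)[of w] B by auto
  qed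
qed

text \<open>The premise \<open>t\<close> excludes the empty set because the empty sum is divisible
  by \<open>m\<close>.\<close>

lemma exists_zero_block_free:
  fixes m :: int
  assumes fin: "finite B" and card: "card B \<le> 4"
    and nz: "\<And>x. x \<in> B \<Longrightarrow> \<not> m dvd x"
    and inc: "\<And>x y. x \<in> B \<Longrightarrow> y \<in> B \<Longrightarrow> m dvd x - y \<Longrightarrow> x = y"
    and t: "B \<noteq> {} \<Longrightarrow> \<not> m dvd \<Sum>B"
  shows "\<exists>xs. distinct xs \<and> set xs = B \<and> zero_block_free m xs"
proof -
  from card consider "card B = 0" | "card B = 1" | "card B = 2" | "card B = 3" | "card B = 4"
    by linarith
  then show ?thesis
  proof cases
    case 1
    with fin show ?thesis
      by (intro exI[of _ "[]"]) auto
  next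
    case 2
    then obtain x where "B = {x}"
      by (auto simp: card_1_singleton_iff)
    with nz show ?thesis
      by (intro exI[of _ "[x]"]) (auto simp: zero_block_free_simps)
  next
    case 3
    then obtain x y where "B = {x, y}" "x \<noteq> y"
      by (auto simp: card_2_iff)
    with nz t show ?thesis
      by (intro exI[of _ "[x, y]"]) (auto simp: zero_block_free_simps)
  next
    case 4
    then obtain x y z where "B = {x, y, z}" "distinct [x, y, z]"
      by (auto simp: card_3_iff)
    with t show ?thesis
      by (intro exists_zero_block_free_3[OF _ _ nz inc]) (auto simp: ac_simps)
  next
    case 5
    then have "B \<noteq> {}"
      by auto
    with 5 t show ?thesis
      by (intro exists_zero_block_free_4[OF _ nz inc]) auto
  qed
qed

text \<open>Partial sums start at length one, so the difference of two of them is the sum of a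
  nonempty block of \<open>xs\<close>, in which the leading \<open>c\<close> cancels.\<close>

lemma inj_on_partial_sums:
  fixes m :: int
  assumes free: "zero_block_free m xs"
  shows "inj_on (\<lambda>j. sum_list (take j (c # xs)) mod m) {1..Suc (length xs)}"
proof (rule linorder_inj_onI')
  fix i j
  assume "i < j" "i \<in> {1..Suc (length xs)}" "j \<in> {1..Suc (length xs)}"
  then obtain i' d where i': "i = Suc i'" "j = Suc (i' + d)" "d > 0" "i' + d \<le> length xs"
    using that[of "i - 1" "j - i"] by auto
  define ys where "ys = take d (drop i' xs)"
  have "ys \<noteq> []" "sublist ys xs"
    using i' by (auto simp: ys_def intro: sublist_order.order_trans)
  with free have "\<not> m dvd sum_list ys"
    by (simp add: zero_block_free_def)
  moreover have "sum_list (take j (c # xs)) - sum_list (take i (c # xs)) = sum_list ys"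
    using i' by (simp add: ys_def take_add)
  ultimately show "sum_list (take i (c # xs)) mod m \<noteq> sum_list (take j (c # xs)) mod m"
    by (metis mod_eq_dvd_iff)
qed

theorem theorem1:
  fixes n k :: nat and A :: "int set"
  assumes "n \<ge> 1"
    and "A \<subseteq> carrier (integer_mod_group n) - {\<one>\<^bsub>integer_mod_group n\<^esub>}"
    and "card A = k"
    and "k \<le> 5"
  shows "\<exists>a :: nat \<Rightarrow> int. bij_betw a {1..k} A \<and>
    inj_on (\<lambda>j. \<Otimes>\<^bsub>integer_mod_group n\<^esub>i\<in>{1..j}. a i) {1..k}"
proof (cases "A = {}")
  case True
  with assms show ?thesis
    by (auto simp: bij_betw_def)
next
  case False
  let ?m = "int n"
  have carrier: "carrier (integer_mod_group n) = {0..<?m}"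
    using assms(1) by (simp add: carrier_integer_mod_group)
  with assms(2) have sub: "A \<subseteq> {0..<?m} - {0}"
    by simp
  have A: "0 < x" "x < ?m" if "x \<in> A" for x
    using subsetD[OF sub that] by auto
  have fin: "finite A"
    using sub by (rule finite_subset) simp
  have nz: "\<not> ?m dvd x" if "x \<in> A" for x
    using A[OF that] by (simp add: zdvd_not_zless)
  have inc: "x = y" if "x \<in> A" "y \<in> A" "?m dvd x - y" for x y
    using A[OF that(1)] A[OF that(2)] that(3) by (metis mod_eq_dvd_iff mod_pos_pos_trivial less_le)
  \<comment> \<open>If no element served, all elements of \<open>A\<close> would be congruent to the
    total, so \<open>A\<close> would be a singleton and the condition vacuous.\<close>
  obtain c where c: "c \<in> A" "A - {c} \<noteq> {} \<Longrightarrow> \<not> ?m dvd \<Sum>A - c"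
  proof (cases "\<exists>c\<in>A. \<not> ?m dvd \<Sum>A - c")
    case True
    then show ?thesis
      using that by blast
  next
    case all: False
    obtain c where "c \<in> A"
      using False by blast
    moreover have "x = c" if "x \<in> A" for x
      using inc[of x c] that \<open>c \<in> A\<close> all dvd_diff[of ?m "\<Sum>A - c" "\<Sum>A - x"] by auto
    ultimately show ?thesis
      using that by blast
  qed
  have "\<exists>xs. distinct xs \<and> set xs = A - {c} \<and> zero_block_free ?m xs"
  proof (rule exists_zero_block_free)
    show "\<not> ?m dvd \<Sum>(A - {c})" if "A - {c} \<noteq> {}"
      using c that fin by (simp add: sum_diff1)
  qed (use fin assms c in \<open>auto dest: nz intro: inc\<close>)
  then obtain xs where xs: "distinct xs" "set xs = A - {c}" "zero_block_free ?m xs"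
    by blast
  \<comment> \<open>List positions count from 0, the required ordering from 1.\<close>
  define a where "a = (\<lambda>i. (c # xs) ! (i - 1))"
  have set: "set (c # xs) = A" and dist: "distinct (c # xs)"
    using xs c by auto
  have k: "k = Suc (length xs)"
    using distinct_card[OF dist] set assms(3) by simp
  have "bij_betw (\<lambda>i. i - 1) {1..k} {..<k}"
    by (rule bij_betw_byWitness[where f' = Suc]) auto
  moreover have "bij_betw ((!) (c # xs)) {..<k} A"
    using dist set k by (intro bij_betw_nth) auto
  ultimately have bij: "bij_betw a {1..k} A"
    using bij_betw_trans by (fastforce simp: a_def comp_def)
  have "(\<Otimes>\<^bsub>integer_mod_group n\<^esub>i\<in>{1..j}. a i) = sum_list (take j (c # xs)) mod ?m"
    if "j \<in> {1..k}" for j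
  proof -
    have "a i \<in> carrier (integer_mod_group n)" if "i \<in> {1..j}" for i
      using bij_betwE[OF bij] that \<open>j \<in> {1..k}\<close> assms(2) by fastforce
    then have "(\<Otimes>\<^bsub>integer_mod_group n\<^esub>i\<in>{1..j}. a i) = (\<Sum>i\<in>{1..j}. a i) mod ?m"
      by (intro finprod_integer_mod_group) auto
    also have "(\<Sum>i\<in>{1..j}. a i) = (\<Sum>i<j. (c # xs) ! i)"
      by (rule sum.reindex_bij_witness[of _ Suc "\<lambda>i. i - 1"]) (auto simp: a_def)
    also have "\<dots> = sum_list (take j (c # xs))"
      using that k by (simp add: sum_list_sum_nth atLeast0LessThan min.absorb1 min.absorb2)
    finally show ?thesis .
  qed
  then have "inj_on (\<lambda>j. \<Otimes>\<^bsub>integer_mod_group n\<^esub>i\<in>{1..j}. a i) {1..k}"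
    unfolding k by (rule iffD2[OF inj_on_cong inj_on_partial_sums[OF xs(3)]])
  with bij show ?thesis
    by blast
qed

end
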